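(* Suppose there exists a constant $d \ge 2$ such that $\Delta_s - \Delta_{s+1} \le d$ for all integers $s \ge 2$. Then $$\lim_{s \to \infty} \frac{\Delta_s}{s} = 0.$$
   Context: For positive integers $k$ and $s$, the Ramsey number $R(k,s)$ is the smallest positive integer $n$ such that every coloring of the edges of the complete graph $K_n$ with two colors contains a copy of $K_k$ in the first color or a copy of $K_s$ in the second color. For integers $s \ge 2$, define $\Delta_s = R(3,s) - R(3,s-1)$. *)

theory Defs
  imports "HOL-Analysis.Analysis" "HOL-Library.Ramsey"
begin

text \<open>An edge of the complete graph on \<open>{..<n}\<close> is a 2-element subset, and a colouring of the edges
  is a function into the colours 0 and 1; \<open>partn_lst {..<n} [k, s] 2\<close> then says that every such
  colouring has a clique of size \<open>k\<close> in colour 0 or a clique of size \<open>s\<close> in colour 1.\<close>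

definition ramsey_number :: "nat \<Rightarrow> nat \<Rightarrow> nat"
  where "ramsey_number k s = (LEAST n::nat. 0 < n \<and> partn_lst {..<n} [k, s] 2)"

text \<open>The least element in question exists.\<close>

lemma ramsey_number_pos_partn:
  "0 < ramsey_number k s \<and> partn_lst {..<ramsey_number k s} [k, s] 2"
proof -
  obtain N :: nat where "partn_lst {..<N} [k, s] 2"
    using ramsey_full by blast
  then have "partn_lst {..<Suc N} [k, s] 2"
    by (rule partn_lst_greater_resource) auto
  then have "\<exists>n::nat. 0 < n \<and> partn_lst {..<n} [k, s] 2"
    using zero_less_Suc by blast
  then show ?thesis
    unfolding ramsey_number_def by (rule LeastI_ex)
qed

text \<open>Meaningful for \<open>s \<ge> 2\<close> only; integer-valued, to avoid truncated subtraction.\<close>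

definition ramsey_delta :: "nat \<Rightarrow> int"
  where "ramsey_delta s = int (ramsey_number 3 s) - int (ramsey_number 3 (s - 1))"

end

theory Submission
  imports Defs
begin

text \<open>If \<open>\<Delta>\<^sub>s > \<epsilon> s\<close>, then, since \<open>\<Delta>\<close> drops by at most \<open>d\<close> per step, \<open>\<Delta>\<close> stays above \<open>\<epsilon> s / 2\<close> for the
  next \<open>\<epsilon> s / (2 d)\<close> steps, so that \<open>R(3, s + \<epsilon> s / (2 d))\<close> is at least \<open>\<epsilon>\<^sup>2 s\<^sup>2 / (4 d)\<close>. For large \<open>s\<close>
  this contradicts \<open>R(3, t) = o(t\<^sup>2)\<close>.

  The bound \<open>R(3, t) = o(t\<^sup>2)\<close> comes from averaging over all independent sets \<open>W\<close> of a triangle-free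
  graph with \<open>n\<close> vertices and without independent sets of size \<open>t\<close> (Alon's form of Shearer's
  argument). All degrees are at most \<open>t\<close>, as neighbourhoods are independent. Give a vertex \<open>v\<close> the
  weight \<open>t [v \<in> W] + \<bar>N(v) \<inter> W\<bar>\<close>. The weights of all vertices sum up to at most \<open>2 t \<bar>W\<bar> \<le> 2 t\<^sup>2\<close>.
  On the other hand, condition on the part of \<open>W\<close> outside \<open>N(v) \<union> {v}\<close>, and let \<open>x\<close> be the number of
  neighbours of \<open>v\<close> that it does not block: the rest of \<open>W\<close> is then either \<open>{v}\<close> or one of the \<open>2\<^sup>x\<close>
  sets of such neighbours, and the mean weight of \<open>v\<close> is \<open>(t + x 2\<^sup>x\<^sup>-\<^sup>1) / (2\<^sup>x + 1)\<close>, which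
  tends to infinity with \<open>t\<close> uniformly in \<open>x\<close>. Hence \<open>n = o(t\<^sup>2)\<close>.\<close>

section \<open>Arithmetic of the mean weight\<close>

lemma sum_card_Pow:
  assumes "finite A"
  shows "2 * (\<Sum>T\<in>Pow A. card T) = card A * 2 ^ card A"
proof -
  have "(\<Sum>T\<in>Pow A. card T) = (\<Sum>T\<in>Pow A. card (A - T))"
    by (rule sum.reindex_bij_witness[of _ "\<lambda>T. A - T" "\<lambda>T. A - T"]) (auto simp: double_diff)
  then have "2 * (\<Sum>T\<in>Pow A. card T) = (\<Sum>T\<in>Pow A. card T + card (A - T))"
    by (simp add: sum.distrib)
  also have "\<dots> = (\<Sum>T\<in>Pow A. card A)"
  proof (rule sum.cong)
    fix T assume "T \<in> Pow A"
    then show "card T + card (A - T) = card A"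
      using assms by (simp add: card_Diff_subset card_mono finite_subset)
  qed simp
  finally show ?thesis
    using assms by (simp add: card_Pow)
qed

text \<open>For a vertex with \<open>x\<close> unblocked neighbours, this bounds the mean weight
  \<open>(D + x * 2 ^ x / 2) / (2 ^ x + 1)\<close> from below by \<open>K\<close>, cleared of
  fractions. Once \<open>x\<close> reaches \<open>4 * K\<close>, the term \<open>x * 2 ^ x\<close>
  suffices alone; for smaller \<open>x\<close> the denominator is bounded and \<open>D\<close>
  suffices, whence the threshold on \<open>D\<close>.\<close>

lemma weight_ge_of_large:
  fixes D K x :: nat
  assumes D: "K * (2 ^ (4 * K) + 1) \<le> D"
  shows "2 * K * (2 ^ x + 1) \<le> 2 * D + x * 2 ^ x"
proof (cases "4 * K \<le> x")
  case True
  have "2 * K * (2 ^ x + 1) \<le> 2 * K * (2 ^ x + 2 ^ x)"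
    by (intro mult_left_mono add_mono) auto
  also have "\<dots> = (4 * K) * 2 ^ x"
    by simp
  also have "\<dots> \<le> x * 2 ^ x"
    using True by (intro mult_right_mono) auto
  finally show ?thesis
    by simp
next
  case False
  then have "K * (2 ^ x + 1) \<le> K * (2 ^ (4 * K) + 1)"
    by (intro mult_left_mono add_mono power_increasing) auto
  with D have "K * (2 ^ x + 1) \<le> D"
    by (rule order_trans[rotated])
  then have "2 * (K * (2 ^ x + 1)) \<le> 2 * D"
    by (rule mult_left_mono) simp
  then show ?thesis
    by (simp add: mult.assoc)
qed

section \<open>Finite graphs: the total weight from above\<close>

locale finite_graph =
  fixes V :: "'a set" and adj :: "'a \<Rightarrow> 'a \<Rightarrow> bool"
  assumes finite_V: "finite V"
    and sym_adj: "adj u v \<Longrightarrow> adj v u"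
    and irrefl_adj: "\<not> adj v v"
begin

definition nbhd :: "'a \<Rightarrow> 'a set"
  where "nbhd v = {u \<in> V. adj v u}"

definition indep_sets :: "'a set set"
  where "indep_sets = {W. W \<subseteq> V \<and> (\<forall>u\<in>W. \<forall>v\<in>W. \<not> adj u v)}"

lemma finite_indep_sets: "finite indep_sets"
  unfolding indep_sets_def
  by (rule finite_subset[of _ "Pow V"]) (auto simp: finite_V)

lemma finite_nbhd: "finite (nbhd v)"
  unfolding nbhd_def using finite_V by auto

lemma finite_indep: "W \<in> indep_sets \<Longrightarrow> finite W"
  unfolding indep_sets_def by (auto intro: finite_subset finite_V)

definition weight :: "nat \<Rightarrow> 'a \<Rightarrow> 'a set \<Rightarrow> nat"
  where "weight D v W = (if v \<in> W then D else 0) + card (nbhd v \<inter> W)"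

text \<open>Double counting: each member of \<open>W\<close> contributes \<open>D\<close> by its own
  membership, and its degree, again at most \<open>D\<close>, by being a neighbour of
  others.\<close>

lemma sum_weight_le:
  assumes W: "W \<in> indep_sets" and deg: "\<And>v. v \<in> V \<Longrightarrow> card (nbhd v) \<le> D"
  shows "(\<Sum>v\<in>V. weight D v W) \<le> 2 * D * card W"
proof -
  have fW: "finite W" and WV: "W \<subseteq> V"
    using W finite_indep by (auto simp: indep_sets_def)
  have "(\<Sum>v\<in>V. card (nbhd v \<inter> W)) = (\<Sum>v\<in>V. \<Sum>w\<in>W. if adj v w then 1 else 0)"
  proof (rule sum.cong)
    fix v assume "v \<in> V"
    have "nbhd v \<inter> W = {w \<in> W. adj v w}"
      using WV by (auto simp: nbhd_def)
    then show "card (nbhd v \<inter> W) = (\<Sum>w\<in>W. if adj v w then 1 else 0)"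
      using fW by (simp add: sum.If_cases Int_def)
  qed simp
  also have "\<dots> = (\<Sum>w\<in>W. \<Sum>v\<in>V. if adj v w then 1 else 0)"
    by (rule sum.swap)
  also have "\<dots> = (\<Sum>w\<in>W. card (nbhd w))"
  proof (rule sum.cong)
    fix w
    have "nbhd w = {v \<in> V. adj v w}"
      using sym_adj unfolding nbhd_def by blast
    then show "(\<Sum>v\<in>V. if adj v w then 1 else 0) = card (nbhd w)"
      using finite_V by (simp add: sum.If_cases Int_def)
  qed simp
  also have "\<dots> \<le> (\<Sum>w\<in>W. D)"
    using deg WV by (intro sum_mono) auto
  finally have nb: "(\<Sum>v\<in>V. card (nbhd v \<inter> W)) \<le> D * card W"
    by (simp add: mult.commute)
  have "(\<Sum>v\<in>V. if v \<in> W then D else 0) = D * card W"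
    using finite_V WV by (simp add: sum.If_cases Int_absorb1)
  then show ?thesis
    using nb by (simp add: weight_def sum.distrib)
qed

end

section \<open>Triangle-free graphs: the mean weight from below\<close>

locale finite_triangle_free = finite_graph +
  assumes triangle_free: "adj u v \<Longrightarrow> adj v w \<Longrightarrow> \<not> adj u w"
begin

lemma nbhd_indep: "nbhd v \<in> indep_sets"
  using triangle_free sym_adj unfolding nbhd_def indep_sets_def by blast

text \<open>This is the bound on the conditional mean of the weight of \<open>v\<close>, given the
  part \<open>H\<close> of \<open>W\<close> outside the closed neighbourhood of
  \<open>v\<close>.\<close>

lemma sum_weight_fibre_ge:
  assumes v: "v \<in> V" and D: "K * (2 ^ (4 * K) + 1) \<le> D"
    and H: "H \<in> indep_sets" "H \<inter> insert v (nbhd v) = {}"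
  defines "F \<equiv> {W \<in> indep_sets. W - insert v (nbhd v) = H}"
  shows "K * card F \<le> (\<Sum>W\<in>F. weight D v W)"
proof -
  define A where "A = {u \<in> nbhd v. \<forall>h\<in>H. \<not> adj u h}"
  have fA: "finite A"
    unfolding A_def using finite_nbhd by auto
  have AH: "A \<inter> H = {}" and vA: "v \<notin> A" and vH: "v \<notin> H" and vN: "v \<notin> nbhd v"
    using H irrefl_adj by (auto simp: A_def nbhd_def)
  \<comment> \<open>A member containing \<open>v\<close> has no neighbour of \<open>v\<close>. One
    avoiding \<open>v\<close> extends \<open>H\<close> by unblocked neighbours only, and any set of
    these will do, as \<open>nbhd v\<close> is independent.\<close>
  have F: "F = insert (insert v H) ((\<lambda>T. H \<union> T) ` Pow A)" (is "F = ?G")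
  proof (intro subset_antisym subsetI)
    fix W assume "W \<in> F"
    then have W: "W \<in> indep_sets" and WH: "W - insert v (nbhd v) = H"
      by (auto simp: F_def)
    show "W \<in> ?G"
    proof (cases "v \<in> W")
      case True
      then have "W \<inter> nbhd v = {}"
        using W by (auto simp: indep_sets_def nbhd_def)
      then have "W = insert v H"
        using WH True by blast
      then show ?thesis by simp
    next
      case False
      have "W \<inter> nbhd v \<subseteq> A"
        using W WH unfolding A_def indep_sets_def by blast
      moreover have "W = H \<union> (W \<inter> nbhd v)"
        using WH False by blast
      ultimately show ?thesis by blast
    qed
  next
    fix W assume "W \<in> ?G"
    then consider "W = insert v H" | T where "T \<subseteq> A" "W = H \<union> T"
      by auto
    then show "W \<in> F"
    proof cases
      case 1
      have "\<not> adj v h \<and> \<not> adj h v" if "h \<in> H" for h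
        using that H sym_adj unfolding indep_sets_def nbhd_def by blast
      then show ?thesis
        using 1 H v irrefl_adj by (auto simp: F_def indep_sets_def)
    next
      case 2
      have "\<not> adj t h \<and> \<not> adj h t" if "h \<in> H" "t \<in> T" for h t
        using that 2 sym_adj unfolding A_def by blast
      moreover have "\<not> adj t t'" if "t \<in> T" "t' \<in> T" for t t'
        using that 2 nbhd_indep[of v] unfolding A_def indep_sets_def by blast
      moreover have "T \<subseteq> nbhd v" "nbhd v \<subseteq> V"
        using 2 by (auto simp: A_def nbhd_def)
      ultimately show ?thesis
        using 2 H by (auto simp: F_def indep_sets_def)
    qed
  qed
  have inj: "inj_on (\<lambda>T. H \<union> T) (Pow A)"
    using AH by (auto simp: inj_on_def)
  have notin: "insert v H \<notin> (\<lambda>T. H \<union> T) ` Pow A"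
    using vA vH by blast
  have cardF: "card F = 2 ^ card A + 1"
    unfolding F using notin fA by (simp add: card_image[OF inj] card_Pow)
  have "weight D v (H \<union> T) = card T" if "T \<subseteq> A" for T
  proof -
    have "nbhd v \<inter> (H \<union> T) = T" "v \<notin> H \<union> T"
      using that H vA vH by (auto simp: A_def)
    then show ?thesis by (simp add: weight_def)
  qed
  then have "(\<Sum>W\<in>(\<lambda>T. H \<union> T) ` Pow A. weight D v W) = (\<Sum>T\<in>Pow A. card T)"
    by (simp add: sum.reindex[OF inj])
  moreover have "D \<le> weight D v (insert v H)"
    by (simp add: weight_def)
  ultimately have "D + (\<Sum>T\<in>Pow A. card T) \<le> (\<Sum>W\<in>F. weight D v W)"
    unfolding F using notin fA by simp
  moreover have "2 * K * (2 ^ card A + 1) \<le> 2 * D + 2 * (\<Sum>T\<in>Pow A. card T)"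
    using weight_ge_of_large[OF D] by (simp add: sum_card_Pow[OF fA])
  then have "K * card F \<le> D + (\<Sum>T\<in>Pow A. card T)"
    unfolding cardF by simp
  ultimately show ?thesis by simp
qed

lemma sum_weight_ge:
  assumes v: "v \<in> V" and D: "K * (2 ^ (4 * K) + 1) \<le> D"
  shows "K * card indep_sets \<le> (\<Sum>W\<in>indep_sets. weight D v W)"
proof -
  \<comment> \<open>The fibres of \<open>r\<close> partition \<open>indep_sets\<close>, so the
    conditional bounds add up.\<close>
  define r where "r W = W - insert v (nbhd v)" for W
  have "K * card indep_sets = (\<Sum>W\<in>indep_sets. K)"
    by simp
  also have "\<dots> = (\<Sum>H\<in>r ` indep_sets. \<Sum>W | W \<in> indep_sets \<and> r W = H. K)"
    using finite_indep_sets by (rule sum.image_gen)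
  also have "\<dots> \<le> (\<Sum>H\<in>r ` indep_sets. \<Sum>W | W \<in> indep_sets \<and> r W = H. weight D v W)"
  proof (rule sum_mono)
    fix H assume "H \<in> r ` indep_sets"
    then have "H \<in> indep_sets" and "H \<inter> insert v (nbhd v) = {}"
      by (auto simp: r_def indep_sets_def)
    from sum_weight_fibre_ge[OF v D this]
    show "(\<Sum>W | W \<in> indep_sets \<and> r W = H. K) \<le> (\<Sum>W | W \<in> indep_sets \<and> r W = H. weight D v W)"
      by (simp add: r_def mult.commute)
  qed
  also have "\<dots> = (\<Sum>W\<in>indep_sets. weight D v W)"
    using finite_indep_sets by (rule sum.image_gen[symmetric])
  finally show ?thesis .
qed

text \<open>The weights are summed over all pairs of a vertex and an independent set in both orders.
  Here \<open>s\<close> takes the place of \<open>D\<close> twice: as a degree bound, because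
  neighbourhoods are independent, and as a number above the threshold.\<close>

lemma card_vertices_le:
  assumes indep: "\<And>W. W \<in> indep_sets \<Longrightarrow> card W \<le> s" and s: "K * (2 ^ (4 * K) + 1) \<le> s"
  shows "K * card V \<le> 2 * s\<^sup>2"
proof -
  have deg: "card (nbhd v) \<le> s" for v
    by (rule indep[OF nbhd_indep])
  have "(K * card V) * card indep_sets = (\<Sum>v\<in>V. K * card indep_sets)"
    by simp
  also have "\<dots> \<le> (\<Sum>v\<in>V. \<Sum>W\<in>indep_sets. weight s v W)"
    by (rule sum_mono, rule sum_weight_ge[OF _ s])
  also have "\<dots> = (\<Sum>W\<in>indep_sets. \<Sum>v\<in>V. weight s v W)"
    by (rule sum.swap)
  also have "\<dots> \<le> (\<Sum>W\<in>indep_sets. 2 * s\<^sup>2)"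
  proof (rule sum_mono)
    fix W assume W: "W \<in> indep_sets"
    have "(\<Sum>v\<in>V. weight s v W) \<le> 2 * s * card W"
      by (rule sum_weight_le[OF W deg])
    also have "\<dots> \<le> 2 * s * s"
      by (rule mult_le_mono2[OF indep[OF W]])
    finally show "(\<Sum>v\<in>V. weight s v W) \<le> 2 * s\<^sup>2"
      by (simp add: power2_eq_square)
  qed
  also have "\<dots> = (2 * s\<^sup>2) * card indep_sets"
    by simp
  finally have "(K * card V) * card indep_sets \<le> (2 * s\<^sup>2) * card indep_sets" .
  moreover have "{} \<in> indep_sets"
    by (simp add: indep_sets_def)
  then have "card indep_sets > 0"
    using finite_indep_sets by (auto simp: card_gt_0_iff)
  ultimately show ?thesis
    by (metis mult_le_cancel2)
qed

end

section \<open>Colourings, and R(3,s) = o(s^2)\<close>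

lemma no_partn_lst_3_bound:
  assumes np: "\<not> partn_lst {..<n} [3, s] 2" and s: "K * (2 ^ (4 * K) + 1) \<le> s"
  shows "K * n \<le> 2 * s\<^sup>2"
proof -
  obtain f where f: "f \<in> nsets {..<n} 2 \<rightarrow> {..<length [3, s]}"
    and mono: "\<not> (\<exists>i<length [3, s]. \<exists>H\<in>nsets {..<n} ([3, s] ! i). f ` nsets H 2 \<subseteq> {i})"
    using np unfolding partn_lst_def monochromatic_def by blast
  have no0: "\<not> f ` nsets H 2 \<subseteq> {0}" if "H \<in> nsets {..<n} 3" for H
    using mono that by (auto dest!: spec[of _ 0])
  have no1: "\<not> f ` nsets H 2 \<subseteq> {1}" if "H \<in> nsets {..<n} s" for H
    using mono that by (auto dest!: spec[of _ "Suc 0"])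
  have f01: "f {u, v} = 0 \<or> f {u, v} = 1" if "u < n" "v < n" "u \<noteq> v" for u v
  proof -
    have "{u, v} \<in> nsets {..<n} 2"
      using that by (auto simp: nsets_def)
    with f have "f {u, v} \<in> {..<length [3, s]}"
      by (rule funcset_mem)
    then show ?thesis
      by (simp add: less_Suc_eq)
  qed
  \<comment> \<open>With colour 0 as adjacency, triangles are cliques of size 3 in colour 0, and
    independent sets are cliques in colour 1.\<close>
  define adj where "adj u v \<longleftrightarrow> u < n \<and> v < n \<and> u \<noteq> v \<and> f {u, v} = 0" for u v
  interpret finite_triangle_free "{..<n}" adj
  proof
    fix u v w assume uv: "adj u v" and vw: "adj v w"
    show "\<not> adj u w"
    proof
      assume uw: "adj u w"
      have "{u, v, w} \<in> nsets {..<n} 3"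
        using uv vw uw by (auto simp: adj_def nsets_def)
      moreover have "f e = 0" if e2: "e \<in> nsets {u, v, w} 2" for e
      proof -
        from e2 obtain x y where e: "e = {x, y}" "x \<in> {u, v, w}" "y \<in> {u, v, w}" "x \<noteq> y"
          by (rule nsets2_E)
        have "f {u, v} = 0" "f {v, w} = 0" "f {u, w} = 0"
          using uv vw uw by (simp_all add: adj_def)
        moreover have "e = {u, v} \<or> e = {v, w} \<or> e = {u, w}"
          using e by blast
        ultimately show ?thesis
          by metis
      qed
      then have "f ` nsets {u, v, w} 2 \<subseteq> {0}"
        by (intro image_subsetI) simp
      ultimately show False
        using no0[of "{u, v, w}"] by simp
    qed
  qed (simp_all add: adj_def insert_commute)
  have "card W \<le> s" if W: "W \<in> indep_sets" for W
  proof (rule ccontr)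
    assume "\<not> card W \<le> s"
    then have "s \<le> card W"
      by simp
    \<comment> \<open>\<open>nsets\<close> asks for a clique of size exactly
      \<open>s\<close>.\<close>
    then obtain T where T: "T \<subseteq> W" "card T = s" "finite T"
      by (rule obtain_subset_with_card_n)
    have Tn: "T \<subseteq> {..<n}" and indep: "\<And>u v. u \<in> T \<Longrightarrow> v \<in> T \<Longrightarrow> \<not> adj u v"
      using T W by (auto simp: indep_sets_def)
    have "T \<in> nsets {..<n} s"
      using T Tn by (auto simp: nsets_def)
    moreover have "f {u, v} = 1" if "u \<in> T" "v \<in> T" "u \<noteq> v" for u v
    proof -
      have "u < n" "v < n"
        using that Tn by auto
      then show ?thesis
        using f01[of u v] indep[of u v] that by (simp add: adj_def)
    qed
    then have "f ` nsets T 2 \<subseteq> {1}"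
      by (auto simp: nsets_2_eq)
    ultimately show False
      using no1[of T] by simp
  qed
  from card_vertices_le[OF this s] show ?thesis
    by simp
qed

lemma ramsey_number_3_bound:
  assumes "K * (2 ^ (4 * K) + 1) \<le> s"
  shows "K * ramsey_number 3 s \<le> 2 * s\<^sup>2 + K"
proof (cases "ramsey_number 3 s = 1")
  case False
  \<comment> \<open>The bound applies to a colouring on one vertex fewer, which costs the summand
    \<open>K\<close>. The value 1 is treated apart because the \<open>LEAST\<close> ranges over
    positive \<open>n\<close> only.\<close>
  define n where "n = ramsey_number 3 s - 1"
  have "n > 0" and Suc_n: "ramsey_number 3 s = Suc n"
    using False ramsey_number_pos_partn[of 3 s] by (auto simp: n_def)
  then have "n < (LEAST n::nat. 0 < n \<and> partn_lst {..<n} [3, s] 2)"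
    by (simp add: ramsey_number_def)
  then have "\<not> partn_lst {..<n} [3, s] 2"
    using not_less_Least \<open>n > 0\<close> by blast
  from no_partn_lst_3_bound[OF this assms] show ?thesis
    by (simp add: Suc_n)
qed simp

lemma ramsey_number_3_little_o:
  fixes \<delta> :: real
  assumes "\<delta> > 0"
  shows "\<forall>\<^sub>F s in sequentially. real (ramsey_number 3 s) \<le> \<delta> * (real s)\<^sup>2"
proof -
  \<comment> \<open>After multiplication by \<open>K\<close>, the budget
    \<open>K * \<delta> * s\<^sup>2\<close> is split in halves: this choice of \<open>K\<close> fits
    \<open>2 * s\<^sup>2\<close> into one, and \<open>M\<close> below makes \<open>s\<close> large
    enough for the summand \<open>K\<close> to fit into the other.\<close>
  obtain K :: nat where K: "4 / \<delta> < real K"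
    using reals_Archimedean2 by blast
  have Kpos: "real K > 0"
    using K assms by (smt (verit) divide_pos_pos)
  obtain M :: nat where M: "2 / \<delta> < real M"
    using reals_Archimedean2 by blast
  show ?thesis
    unfolding eventually_sequentially
  proof (intro exI allI impI)
    fix s assume s: "K * (2 ^ (4 * K) + 1) + M + 1 \<le> s"
    have "K * (2 ^ (4 * K) + 1) \<le> s"
      using s by linarith
    from ramsey_number_3_bound[OF this]
    have "real (K * ramsey_number 3 s) \<le> real (2 * s\<^sup>2 + K)"
      by (rule of_nat_mono)
    then have "real K * real (ramsey_number 3 s) \<le> 2 * (real s)\<^sup>2 + real K"
      by simp
    moreover have "2 * (real s)\<^sup>2 \<le> real K * (\<delta> / 2 * (real s)\<^sup>2)"
    proof -
      have "2 \<le> real K * (\<delta> / 2)"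
        using K assms by (simp add: field_simps)
      from mult_right_mono[OF this zero_le_power2[of "real s"]] show ?thesis
        by (simp only: mult.assoc)
    qed
    moreover have "real K \<le> real K * (\<delta> / 2 * (real s)\<^sup>2)"
    proof -
      have "M \<le> s" "1 \<le> s"
        using s by linarith+
      then have "2 / \<delta> \<le> real s" "1 \<le> real s"
        using M by linarith+
      then have "2 / \<delta> * 1 \<le> real s * real s"
        using assms by (intro mult_mono) auto
      then have "1 \<le> \<delta> / 2 * (real s)\<^sup>2"
        using assms by (simp add: field_simps power2_eq_square)
      then show ?thesis
        using Kpos by simp
    qed
    moreover have "real K * (\<delta> * (real s)\<^sup>2) = 2 * (real K * (\<delta> / 2 * (real s)\<^sup>2))"
      by simp
    ultimately have "real K * real (ramsey_number 3 s) \<le> real K * (\<delta> * (real s)\<^sup>2)"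
      by linarith
    then show "real (ramsey_number 3 s) \<le> \<delta> * (real s)\<^sup>2"
      using Kpos by simp
  qed
qed

section \<open>From slowly falling differences to the limit\<close>

lemma ramsey_number_mono:
  assumes "s \<le> t"
  shows "ramsey_number k s \<le> ramsey_number k t"
proof -
  have "partn_lst {..<ramsey_number k t} [k, s] 2"
    by (rule partn_lst_less[OF conjunct2[OF ramsey_number_pos_partn]])
      (use assms in \<open>auto simp: less_Suc_eq\<close>)
  then show ?thesis
    unfolding ramsey_number_def[of k s] using ramsey_number_pos_partn
    by (intro Least_le) auto
qed

lemma ramsey_delta_nonneg: "ramsey_delta s \<ge> 0"
  unfolding ramsey_delta_def using ramsey_number_mono[of "s - 1" s 3] by simp

lemma sum_ramsey_delta:
  assumes "s \<ge> 1"
  shows "(\<Sum>j\<le>m. ramsey_delta (s + j)) = int (ramsey_number 3 (s + m)) - int (ramsey_number 3 (s - 1))"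
  by (induction m) (use assms in \<open>auto simp: ramsey_delta_def\<close>)

theorem theorem10:
  fixes d :: real
  assumes "d \<ge> 2"
    and "\<And>s::nat. s \<ge> 2 \<Longrightarrow> real_of_int (ramsey_delta s - ramsey_delta (s + 1)) \<le> d"
  shows "(\<lambda>s::nat. real_of_int (ramsey_delta s) / real s) \<longlonglongrightarrow> 0"
proof (rule order_tendstoI)
  fix a :: real assume "a < 0"
  moreover have "0 \<le> real_of_int (ramsey_delta s) / real s" for s
    using ramsey_delta_nonneg by simp
  ultimately show "\<forall>\<^sub>F s in sequentially. a < real_of_int (ramsey_delta s) / real s"
    by (intro always_eventually allI) (rule less_le_trans)
next
  fix a :: real assume a: "0 < a"
  have d: "d > 0"
    using assms(1) by simp
  define e where "e = a / 2"
  have e: "e > 0" "e < a"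
    using a by (auto simp: e_def)
  \<comment> \<open>Chosen so that \<open>s + y = c * s\<close> for the number \<open>y\<close> of
    steps below.\<close>
  define c where "c = 1 + e / (2 * d)"
  have c: "c > 0"
    using e d by (simp add: c_def add_pos_pos)
  \<comment> \<open>Makes \<open>\<delta> * (c * s)\<^sup>2\<close> half of
    \<open>y * (e * s / 2)\<close>, the growth forced below.\<close>
  define \<delta> where "\<delta> = e\<^sup>2 / (8 * d * c\<^sup>2)"
  have "\<delta> > 0"
    using e d c by (simp add: \<delta>_def)
  from ramsey_number_3_little_o[OF this] obtain N
    where N: "\<And>t. t \<ge> N \<Longrightarrow> real (ramsey_number 3 t) \<le> \<delta> * (real t)\<^sup>2"
    unfolding eventually_sequentially by blast
  have le: "real_of_int (ramsey_delta s) \<le> e * real s" if s: "s \<ge> N + 2" for s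
  proof (rule ccontr)
    assume big: "\<not> real_of_int (ramsey_delta s) \<le> e * real s"
    define y where "y = e * real s / (2 * d)"
    have y: "y \<ge> 0"
      using e d by (simp add: y_def)
    \<comment> \<open>Within \<open>y\<close> steps the differences lose at most
      \<open>d * y = e * s / 2\<close>, half of their initial lower bound.\<close>
    define m where "m = nat \<lfloor>y\<rfloor>"
    have m: "real m \<le> y" "y < real m + 1"
      using y by (auto simp: m_def)
    have drop: "real_of_int (ramsey_delta (s + j)) \<ge> real_of_int (ramsey_delta s) - d * real j" for j
    proof (induction j)
      case (Suc j)
      have "real_of_int (ramsey_delta (s + j) - ramsey_delta (s + j + 1)) \<le> d"
        using s by (intro assms(2)) auto
      with Suc show ?case
        by (simp add: algebra_simps)
    qed simp
    have "e * real s / 2 \<le> real_of_int (ramsey_delta (s + j))" if "j \<le> m" for j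
    proof -
      have "d * real j \<le> d * y"
        using that m d by (intro mult_left_mono) auto
      also have "\<dots> = e * real s / 2"
        using d by (simp add: y_def)
      finally show ?thesis
        using drop[of j] big by simp
    qed
    then have "(\<Sum>j\<le>m. e * real s / 2) \<le> (\<Sum>j\<le>m. real_of_int (ramsey_delta (s + j)))"
      by (intro sum_mono) auto
    also have "\<dots> = real_of_int (\<Sum>j\<le>m. ramsey_delta (s + j))"
      by simp
    also have "\<dots> \<le> real (ramsey_number 3 (s + m))"
      using s by (simp add: sum_ramsey_delta del: of_int_sum)
    also have "\<dots> \<le> \<delta> * (real (s + m))\<^sup>2"
      using s by (intro N) auto
    also have "\<dots> \<le> \<delta> * (c * real s)\<^sup>2"
    proof -
      have "real (s + m) \<le> c * real s"
        using m by (simp add: c_def y_def algebra_simps)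
      then show ?thesis
        using \<open>\<delta> > 0\<close> by (intro mult_left_mono power_mono) auto
    qed
    also have "\<dots> = e\<^sup>2 * (real s)\<^sup>2 / (8 * d)"
      using c by (simp add: \<delta>_def power_mult_distrib)
    also have "\<dots> < e\<^sup>2 * (real s)\<^sup>2 / (4 * d)"
      using e d s by (intro divide_strict_left_mono) auto
    also have "\<dots> = y * (e * real s / 2)"
      by (simp add: y_def power2_eq_square)
    \<comment> \<open>The sum over \<open>j \<le> m\<close> has \<open>m + 1\<close> terms, which
      makes up for rounding \<open>y\<close> down.\<close>
    also have "\<dots> \<le> (real m + 1) * (e * real s / 2)"
      using m e by (intro mult_right_mono) auto
    also have "\<dots> = (\<Sum>j\<le>m. e * real s / 2)"
      by (simp add: algebra_simps)
    finally show False
      by simp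
  qed
  have "real_of_int (ramsey_delta s) / real s < a" if "s \<ge> N + 2" for s
  proof -
    have "real_of_int (ramsey_delta s) \<le> e * real s"
      by (rule le[OF that])
    also have "\<dots> < a * real s"
      using e that by simp
    finally show ?thesis
      using that by (simp add: field_simps)
  qed
  then show "\<forall>\<^sub>F s in sequentially. real_of_int (ramsey_delta s) / real s < a"
    unfolding eventually_sequentially by blast
qed

end
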